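(* Let $s$ and $s^*$ be a (suitably scaled) S$_1$-cmc pair in $\mathbb{R}^3$, with sphere centers $c,c^*:V(\mathcal G)\to\mathbb{R}^3$. The Gauss map $n:V(\mathcal G)\to\mathbb{R}^3$, $v\mapsto n_v:=c^*_v-c_v$, between the sphere centers of $s$ and $s^*$, forms a two-sphere Koebe net.
   Context: Combinatorics: $\mathcal G$ is a quad graph, i.e. a cell decomposition of a surface all of whose faces are quadrilaterals, with all interior vertices of even valence. Its edges are divided into "horizontal" (label $i$) and "vertical" (label $j$) edges, alternating around each face. The vertices of a face are $v,v_i,v_{ij},v_j$, where $v_i$ and $v_j$ are the horizontal and vertical neighbors of $v$ and $v_{ij}$ is the fourth vertex. Lift of spheres: $\mathbb{R}^{4,1}$ carries $\langle x,y\rangle_{4,1}=x_1y_1+x_2y_2+x_3y_3+x_4y_4-x_5y_5$; $e_0=\frac12(e_5-e_4)$, $e_\infty=\frac12(e_4+e_5)$. An oriented sphere in $\mathbb{R}^3$ with center $c$ and signed radius $d$ (the sign encodes the orientation) is lifted to $\hat s=\frac1d\big(c+e_0+(\|c\|^2-d^2)e_\infty\big)$, a point with $\langle\hat s,\hat s\rangle_{4,1}=1$. S-isothermic: a map $s$ from $V(\mathcal G)$ to oriented spheres in $\mathbb{R}^3$ is a discrete S-isothermic surface if its lift satisfies on every face $\hat s_{v_{ij}}-\hat s_v=a_{ij}(\hat s_{v_j}-\hat s_{v_i})$ for some $a_{ij}\in\mathbb{R}$ (depending on the face). Centers and signed radii are denoted $c_v,d_v$. It is S$_1$-isothermic if neighboring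 vertex spheres touch; the orientation of the spheres is chosen so that $\langle\hat s_v,\hat s_{v'}\rangle_{4,1}=-1$ on horizontal edges and $=+1$ on vertical edges. Christoffel dual of $s$: the S-isothermic surface $s^*$ whose centers are obtained by integrating $c^*_{v'}-c^*_v=\frac{c_{v'}-c_v}{d_vd_{v'}}$ over the edges $(v,v')$ and whose radii are $d^*_v=\frac1{d_v}$. More generally it is considered up to translation and global scaling, so that $d_vd_v^*=\lambda$ with an arbitrary global constant $\lambda\in\mathbb{R}$. Darboux pair: two S-isothermic surfaces $s,s^+$ whose lifts satisfy, for every edge $(v,v')$, $\hat s^+_{v'}-\hat s_v=a_+(\hat s^+_v-\hat s_{v'})$ for some $a_+\in\mathbb{R}$ (depending on the edge); each is then called a Darboux transform of the other. S-cmc: an S-isothermic surface $s$ is an S-cmc surface if its Christoffel dual $s^*$ is simultaneously a Darboux transform of $s$ (after appropriate scaling and translation); then $s,s^*$ is called an S-cmc pair. An S$_1$-cmc pair is an S-cmc pair in which the surfaces are S$_1$-isothermic (touching spheres). Two-sphere Koebe net: a Q-net $k:V(\mathcal G)\to\mathbb{R}^3$ (i.e. all faces planar) whose edges alternately touch two spheres $S^2_+$ and $S^2_-$, concentric with the unit sphere $S^2$ (centered at the origin), whose radii satisfy $r_+r_-=1$.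
   Formalization: Assumes in addition that the Gauss map n is not constant and that s_v and s*_v never touch (otherwise the claim fails: n = 0, or one sphere has radius 0); the dual may have all orientations reversed, and an edge touches a sphere if its extended line is tangent. *)

theory Defs
  imports "HOL-Analysis.Analysis"
begin

section \<open>Quad graphs\<close>

text \<open>
  A cell decomposition of a surface (possibly with boundary, possibly non-orientable, possibly
  infinite) is encoded by its flags, i.e. the incident triples (vertex, edge, face).
  \<open>flip_vertex\<close>, \<open>flip_edge\<close> and \<open>flip_face\<close> exchange one entry of a flag and keep the two
  others; \<open>flip_face\<close> fixes exactly the flags on boundary edges. The faces, edges and vertices
  are the orbits of the respective two flips, and \<open>vertex_of\<close> names the vertex orbits. In contrast
  to a description by vertex pairs this also admits multiple edges and faces that meet a vertex
  repeatedly, as they occur on closed surfaces.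
\<close>

record ('f, 'v) quad_map =
  flags :: "'f set"
  flip_vertex :: "'f \<Rightarrow> 'f"
  flip_edge :: "'f \<Rightarrow> 'f"
  flip_face :: "'f \<Rightarrow> 'f"
  vertex_of :: "'f \<Rightarrow> 'v"
  horizontal :: "'f \<Rightarrow> bool"

definition verts :: "('f, 'v) quad_map \<Rightarrow> 'v set" where
  "verts G = vertex_of G ` flags G"

definition flip_orbit :: "('f \<Rightarrow> 'f) set \<Rightarrow> 'f \<Rightarrow> 'f set" where
  "flip_orbit T x = {(z, t z) |z t. t \<in> T}\<^sup>* `` {x}"

definition vertex_orbit :: "('f, 'v) quad_map \<Rightarrow> 'f \<Rightarrow> 'f set" where
  "vertex_orbit G = flip_orbit {flip_edge G, flip_face G}"

definition cell_decomposition :: "('f, 'v) quad_map \<Rightarrow> bool" where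
  "cell_decomposition G \<longleftrightarrow>
     flags G \<noteq> {} \<and>
     (\<forall>x\<in>flags G.
        flip_vertex G x \<in> flags G \<and> flip_vertex G (flip_vertex G x) = x \<and> flip_vertex G x \<noteq> x \<and>
        flip_edge G x \<in> flags G \<and> flip_edge G (flip_edge G x) = x \<and> flip_edge G x \<noteq> x \<and>
        flip_face G x \<in> flags G \<and> flip_face G (flip_face G x) = x \<and>
        flip_face G x \<noteq> flip_vertex G x \<and>
        flip_face G (flip_vertex G x) = flip_vertex G (flip_face G x) \<and>
        finite (vertex_orbit G x)) \<and>
     (\<forall>x\<in>flags G. \<forall>y\<in>flags G.
        vertex_of G x = vertex_of G y \<longleftrightarrow> y \<in> vertex_orbit G x) \<and>
     (\<forall>x\<in>flags G. flags G = flip_orbit {flip_vertex G, flip_edge G, flip_face G} x)"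

text \<open>
  \<open>flip_edge \<circ> flip_vertex\<close> walks one step around a face. A face is a quadrilateral if the fourth
  step is the first to return; the first and third steps cannot return, as every step exchanges
  the labels.
  The flags at an interior vertex form a cycle with two flags per edge end, so the valence is half
  of the number of flags at the vertex.
\<close>

definition quad_graph :: "('f, 'v) quad_map \<Rightarrow> bool" where
  "quad_graph G \<longleftrightarrow>
     cell_decomposition G \<and>
     (\<forall>x\<in>flags G.
        ((flip_edge G \<circ> flip_vertex G) ^^ 4) x = x \<and>
        ((flip_edge G \<circ> flip_vertex G) ^^ 2) x \<noteq> x) \<and>
     (\<forall>x\<in>flags G. (\<forall>y\<in>vertex_orbit G x. flip_face G y \<noteq> y) \<longrightarrow>
        even (card (vertex_orbit G x) div 2)) \<and>
     (\<forall>x\<in>flags G.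
        horizontal G (flip_vertex G x) = horizontal G x \<and>
        horizontal G (flip_face G x) = horizontal G x \<and>
        horizontal G (flip_edge G x) = (\<not> horizontal G x))"

text \<open>
  Every flag determines an oriented edge, from \<open>vertex_of G x\<close> to \<open>edge_end G x\<close>. The corner of a
  face at a vertex consists of two flags, one on a horizontal and one on a vertical edge; seen from
  the horizontal one, \<open>v\<close>, \<open>v\<^sub>i\<close>, \<open>v\<^sub>j\<close> and \<open>v\<^sub>i\<^sub>j\<close> are \<open>vertex_of G x\<close>, \<open>edge_end G x\<close>,
  \<open>edge_end G (flip_edge G x)\<close> and \<open>opposite G x\<close>.
\<close>

definition edge_end :: "('f, 'v) quad_map \<Rightarrow> 'f \<Rightarrow> 'v" where
  "edge_end G x = vertex_of G (flip_vertex G x)"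

definition opposite :: "('f, 'v) quad_map \<Rightarrow> 'f \<Rightarrow> 'v" where
  "opposite G x = edge_end G (flip_edge G (flip_vertex G x))"


section \<open>Oriented spheres and their lift\<close>

text \<open>An oriented sphere is given by its center and its signed radius.\<close>

type_synonym osphere = "(real^3) \<times> real"

abbreviation center :: "osphere \<Rightarrow> real^3" where "center \<equiv> fst"
abbreviation radius :: "osphere \<Rightarrow> real" where "radius \<equiv> snd"

text \<open>The space \<open>\<real>\<^sup>4\<^sup>,\<^sup>1\<close>; the coordinates \<open>x\<^sub>1, x\<^sub>2, x\<^sub>3\<close> are collected in the first component.\<close>

type_synonym minkowski = "(real^3) \<times> real \<times> real"

definition lorentz :: "minkowski \<Rightarrow> minkowski \<Rightarrow> real" where
  "lorentz x y =
     fst x \<bullet> fst y + fst (snd x) * fst (snd y) - snd (snd x) * snd (snd y)"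

definition e4 :: minkowski where "e4 = (0, 1, 0)"
definition e5 :: minkowski where "e5 = (0, 0, 1)"
definition e_zero :: minkowski where "e_zero = (1/2) *\<^sub>R (e5 - e4)"
definition e_inf :: minkowski where "e_inf = (1/2) *\<^sub>R (e4 + e5)"

definition lift :: "osphere \<Rightarrow> minkowski" where
  "lift s = (1 / radius s) *\<^sub>R
     ((center s, 0, 0) + e_zero + ((norm (center s))\<^sup>2 - (radius s)\<^sup>2) *\<^sub>R e_inf)"

definition scale_sphere :: "real \<Rightarrow> osphere \<Rightarrow> osphere" where
  "scale_sphere \<rho> s = (\<rho> *\<^sub>R center s, \<rho> * radius s)"

definition spheres_touch :: "osphere \<Rightarrow> osphere \<Rightarrow> bool" where
  "spheres_touch s t \<longleftrightarrow>
     is_singleton (sphere (center s) \<bar>radius s\<bar> \<inter> sphere (center t) \<bar>radius t\<bar>)"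


section \<open>S-isothermic and S-cmc surfaces\<close>

definition S_isothermic :: "('f, 'v) quad_map \<Rightarrow> ('v \<Rightarrow> osphere) \<Rightarrow> bool" where
  "S_isothermic G s \<longleftrightarrow>
     (\<forall>v\<in>verts G. radius (s v) \<noteq> 0) \<and>
     (\<forall>x\<in>flags G. horizontal G x \<longrightarrow>
        (\<exists>a. lift (s (opposite G x)) - lift (s (vertex_of G x)) =
             a *\<^sub>R (lift (s (edge_end G (flip_edge G x))) - lift (s (edge_end G x)))))"

definition S1_isothermic :: "('f, 'v) quad_map \<Rightarrow> ('v \<Rightarrow> osphere) \<Rightarrow> bool" where
  "S1_isothermic G s \<longleftrightarrow>
     S_isothermic G s \<and>
     (\<forall>x\<in>flags G.
        spheres_touch (s (vertex_of G x)) (s (edge_end G x)) \<and>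
        lorentz (lift (s (vertex_of G x))) (lift (s (edge_end G x))) =
          (if horizontal G x then -1 else 1))"

text \<open>
  A Christoffel dual is determined up to translation and global scaling, where the scaling acts on
  the centers by \<open>\<mu>\<close> and on the signed radii by \<open>\<nu>\<close> with \<open>\<bar>\<nu>\<bar> = \<bar>\<mu>\<bar>\<close>. The signs are independent
  of each other, since the orientation of all dual spheres may be reversed simultaneously. This
  freedom is essential for S-cmc surfaces: comparing the components of the lifts shows that,
  on an edge with distinct centers and \<open>d\<^sub>v d\<^sub>v\<^sub>' \<noteq> \<nu>\<close>, a Christoffel dual is a
  Darboux transform only if \<open>\<mu> = - \<nu>\<close>.
\<close>

definition Christoffel_dual ::
  "('f, 'v) quad_map \<Rightarrow> ('v \<Rightarrow> osphere) \<Rightarrow> ('v \<Rightarrow> osphere) \<Rightarrow> bool" where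
  "Christoffel_dual G s sd \<longleftrightarrow>
     S_isothermic G s \<and> S_isothermic G sd \<and>
     (\<exists>\<nu> \<mu>. \<mu> \<noteq> 0 \<and> \<bar>\<nu>\<bar> = \<bar>\<mu>\<bar> \<and>
        (\<forall>x\<in>flags G.
           center (sd (edge_end G x)) - center (sd (vertex_of G x)) =
             (\<mu> / (radius (s (vertex_of G x)) * radius (s (edge_end G x)))) *\<^sub>R
               (center (s (edge_end G x)) - center (s (vertex_of G x)))) \<and>
        (\<forall>v\<in>verts G. radius (s v) * radius (sd v) = \<nu>))"

definition Darboux_pair ::
  "('f, 'v) quad_map \<Rightarrow> ('v \<Rightarrow> osphere) \<Rightarrow> ('v \<Rightarrow> osphere) \<Rightarrow> bool" where
  "Darboux_pair G s sp \<longleftrightarrow>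
     S_isothermic G s \<and> S_isothermic G sp \<and>
     (\<forall>x\<in>flags G. \<exists>a.
        lift (sp (edge_end G x)) - lift (s (vertex_of G x)) =
          a *\<^sub>R (lift (sp (vertex_of G x)) - lift (s (edge_end G x))))"

definition S_cmc_pair ::
  "('f, 'v) quad_map \<Rightarrow> ('v \<Rightarrow> osphere) \<Rightarrow> ('v \<Rightarrow> osphere) \<Rightarrow> bool" where
  "S_cmc_pair G s sd \<longleftrightarrow> Christoffel_dual G s sd \<and> Darboux_pair G s sd"

definition S1_cmc_pair ::
  "('f, 'v) quad_map \<Rightarrow> ('v \<Rightarrow> osphere) \<Rightarrow> ('v \<Rightarrow> osphere) \<Rightarrow> bool" where
  "S1_cmc_pair G s sd \<longleftrightarrow>
     S_cmc_pair G s sd \<and> S1_isothermic G s \<and> S1_isothermic G sd"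

definition gauss_map :: "('v \<Rightarrow> osphere) \<Rightarrow> ('v \<Rightarrow> osphere) \<Rightarrow> 'v \<Rightarrow> real^3" where
  "gauss_map s sd v = center (sd v) - center (s v)"


section \<open>Two-sphere Koebe nets\<close>

definition Q_net :: "('f, 'v) quad_map \<Rightarrow> ('v \<Rightarrow> real^3) \<Rightarrow> bool" where
  "Q_net G k \<longleftrightarrow>
     (\<forall>x\<in>flags G.
        aff_dim {k (vertex_of G x), k (edge_end G x), k (opposite G x),
                 k (edge_end G (flip_edge G x))} \<le> 2)"

text \<open>
  Edges are extended to lines here, as usual for Koebe nets: the point of contact need not lie
  between the two vertices. For an edge with distinct end points, \<open>L\<close> is the line through them.
\<close>

definition edge_touches_sphere :: "real^3 \<Rightarrow> real^3 \<Rightarrow> real \<Rightarrow> bool" where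
  "edge_touches_sphere p q r \<longleftrightarrow>
     (\<exists>L. affine L \<and> aff_dim L = 1 \<and> p \<in> L \<and> q \<in> L \<and> is_singleton (L \<inter> sphere 0 r))"

definition two_sphere_Koebe_net :: "('f, 'v) quad_map \<Rightarrow> ('v \<Rightarrow> real^3) \<Rightarrow> bool" where
  "two_sphere_Koebe_net G k \<longleftrightarrow>
     Q_net G k \<and>
     (\<exists>rp rm. rp > 0 \<and> rm > 0 \<and> rp * rm = 1 \<and>
        (\<forall>x\<in>flags G. edge_touches_sphere (k (vertex_of G x)) (k (edge_end G x))
           (if horizontal G x then rp else rm)))"

end

theory Submission
  imports Defs
begin

text \<open>
  Write \<open>n\<close> for the Gauss map, \<open>d\<close> and \<open>d\<^sup>*\<close> for the radii, with \<open>d d\<^sup>* = \<nu>\<close> and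
  \<open>c\<^sup>*\<^sub>v\<^sub>' - c\<^sup>*\<^sub>v = \<mu> (c\<^sub>v\<^sub>' - c\<^sub>v) / (d\<^sub>v d\<^sub>v\<^sub>')\<close> on the edges. Comparing the
  components of the lifts in the Darboux condition shows that \<open>\<mu> = - \<nu>\<close> unless \<open>n\<close> is constant, that
  \<open>\<parallel>n\<parallel>\<^sup>2 - d\<^sup>2 - (d\<^sup>*)\<^sup>2\<close> takes the same value \<open>C\<close> at all vertices, and that the line
  through \<open>n\<^sub>v\<close> in the direction of the edge \<open>c\<^sub>v\<^sub>' - c\<^sub>v\<close> has squared distance
  \<open>\<parallel>n\<parallel>\<^sup>2 - (d + d\<^sup>*)\<^sup>2 = C - 2 \<nu>\<close> from the origin on horizontal edges and
  \<open>\<parallel>n\<parallel>\<^sup>2 - (d - d\<^sup>*)\<^sup>2 = C + 2 \<nu>\<close> on vertical ones. If one of these vanished, the spheres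
  \<open>s\<^sub>v\<close> and \<open>s\<^sup>*\<^sub>v\<close> would touch or be concentric everywhere. Faces are planar since the edges of \<open>n\<close>
  are parallel to those of the Q-net \<open>c\<close>.
\<close>

section \<open>Lifts and spheres\<close>

text \<open>For the values \<open>-1\<close> and \<open>1\<close> on the edges of an S1-isothermic
  surface, this yields the squared center distances \<open>(d + d')^2\<close> and
  \<open>(d - d')^2\<close>.\<close>

lemma lorentz_lift:
  assumes "radius s \<noteq> 0" "radius t \<noteq> 0"
  shows "2 * radius s * radius t * lorentz (lift s) (lift t) =
    (radius s)\<^sup>2 + (radius t)\<^sup>2 - (norm (center t - center s))\<^sup>2"
proof -
  obtain c d c' d' where [simp]: "s = (c, d)" "t = (c', d')" by (cases s, cases t)
  have "d \<noteq> 0" "d' \<noteq> 0" using assms by auto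
  then show ?thesis
    by (simp add: lorentz_def lift_def e_zero_def e_inf_def e4_def e5_def power2_norm_eq_inner
        inner_diff_left inner_diff_right inner_commute[of c' c])
      (simp add: field_simps power2_eq_square)
qed

lemma lift_components:
  assumes "lift s1 - lift s2 = a *\<^sub>R (lift s3 - lift s4)"
  shows "center s1 /\<^sub>R radius s1 - center s2 /\<^sub>R radius s2 =
      a *\<^sub>R (center s3 /\<^sub>R radius s3 - center s4 /\<^sub>R radius s4)"
    and "1 / radius s1 - 1 / radius s2 = a * (1 / radius s3 - 1 / radius s4)"
    and "((norm (center s1))\<^sup>2 - (radius s1)\<^sup>2) / radius s1 -
         ((norm (center s2))\<^sup>2 - (radius s2)\<^sup>2) / radius s2 =
      a * (((norm (center s3))\<^sup>2 - (radius s3)\<^sup>2) / radius s3 -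
           ((norm (center s4))\<^sup>2 - (radius s4)\<^sup>2) / radius s4)"
proof -
  \<comment> \<open>\<open>p\<close> and \<open>q\<close> are the coefficients of
    \<open>e_inf\<close> and \<open>e_zero\<close> in the lift; its last two coordinates are half
    their difference and half their sum.\<close>
  define p where "p s = ((norm (center s))\<^sup>2 - (radius s)\<^sup>2) / radius s" for s
  define q where "q s = 1 / radius s" for s
  have l: "lift s = (center s /\<^sub>R radius s, (p s - q s) / 2, (p s + q s) / 2)" for s
    by (cases s) (simp add: lift_def e_zero_def e_inf_def e4_def e5_def p_def q_def
        inverse_eq_divide add_divide_distrib diff_divide_distrib)
  note eq = assms[unfolded l]
  show "center s1 /\<^sub>R radius s1 - center s2 /\<^sub>R radius s2 =
      a *\<^sub>R (center s3 /\<^sub>R radius s3 - center s4 /\<^sub>R radius s4)"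
    using eq by simp
  have "(p s1 - q s1) / 2 - (p s2 - q s2) / 2 = a * ((p s3 - q s3) / 2 - (p s4 - q s4) / 2)"
    "(p s1 + q s1) / 2 - (p s2 + q s2) / 2 = a * ((p s3 + q s3) / 2 - (p s4 + q s4) / 2)"
    using eq by simp_all
  then have "p s1 - p s2 = a * (p s3 - p s4)" "q s1 - q s2 = a * (q s3 - q s4)"
    unfolding right_diff_distrib distrib_left diff_divide_distrib add_divide_distrib by linarith+
  then show "1 / radius s1 - 1 / radius s2 = a * (1 / radius s3 - 1 / radius s4)"
    "((norm (center s1))\<^sup>2 - (radius s1)\<^sup>2) / radius s1 -
         ((norm (center s2))\<^sup>2 - (radius s2)\<^sup>2) / radius s2 =
      a * (((norm (center s3))\<^sup>2 - (radius s3)\<^sup>2) / radius s3 -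
           ((norm (center s4))\<^sup>2 - (radius s4)\<^sup>2) / radius s4)"
    by (simp_all add: p_def q_def)
qed

text \<open>For concentric spheres, the antipode of a common point is a second common point as soon
  as the radius is nonzero.\<close>

lemma spheres_touch_imp_center_neq:
  assumes "spheres_touch s t" "radius s \<noteq> 0"
  shows "center s \<noteq> center t"
proof
  assume eq: "center s = center t"
  from assms(1) obtain p
    where p: "sphere (center s) \<bar>radius s\<bar> \<inter> sphere (center t) \<bar>radius t\<bar> = {p}"
    by (auto simp: spheres_touch_def is_singleton_def)
  define u where "u = p - center t"
  define S where "S = sphere (center s) \<bar>radius s\<bar> \<inter> sphere (center t) \<bar>radius t\<bar>"
  have mem: "y \<in> S \<longleftrightarrow> norm (y - center t) = \<bar>radius s\<bar> \<and> norm (y - center t) = \<bar>radius t\<bar>" for y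
    by (simp add: S_def eq dist_norm norm_minus_commute)
  have S: "S = {p}" using p by (simp add: S_def)
  then have "p \<in> S" by simp
  then have u: "norm u = \<bar>radius s\<bar>" "norm u = \<bar>radius t\<bar>" unfolding mem u_def by auto
  then have "center t - u \<in> S" by (simp add: mem)
  then have "center t - u = center t + u" unfolding S by (simp add: u_def)
  then have "u + u = 0" by (metis add_diff_cancel_left diff_add_cancel add_cancel_right_right add.assoc)
  then have "2 *\<^sub>R u = 0" by (simp only: scaleR_2)
  then show False using u(1) assms(2) by simp
qed

text \<open>Since radii are signed, this covers both external contact (equal signs) and internal
  contact (opposite signs). The contact point lies on the line of centers, at the fraction
  \<open>d / \<delta>\<close> of the way.\<close>

lemma spheres_touchI:
  assumes "center s \<noteq> center t"
    and "(norm (center t - center s))\<^sup>2 = (radius s + radius t)\<^sup>2"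
  shows "spheres_touch s t"
proof -
  obtain c d c' d' where [simp]: "s = (c, d)" "t = (c', d')" by (cases s, cases t)
  define n where "n = c' - c"
  define \<delta> where "\<delta> = d + d'"
  have n: "n \<bullet> n = \<delta>\<^sup>2" using assms(2) by (simp add: n_def \<delta>_def power2_norm_eq_inner)
  have "n \<noteq> 0" using assms(1) by (simp add: n_def)
  then have \<delta>: "\<delta> \<noteq> 0" using n by auto
  define p where "p = (d / \<delta>) *\<^sub>R n"
  have "x \<in> sphere c \<bar>d\<bar> \<inter> sphere c' \<bar>d'\<bar> \<longleftrightarrow> x = c + p" for x
  proof -
    define y where "y = x - c"
    have "x \<in> sphere c \<bar>d\<bar> \<inter> sphere c' \<bar>d'\<bar> \<longleftrightarrow> norm y = \<bar>d\<bar> \<and> norm (y - n) = \<bar>d'\<bar>"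
      by (simp add: y_def n_def dist_norm norm_minus_commute)
    also have "\<dots> \<longleftrightarrow> (norm y)\<^sup>2 = d\<^sup>2 \<and> (norm (y - n))\<^sup>2 = d'\<^sup>2"
      by (metis abs_norm_cancel power2_eq_iff_nonneg abs_ge_zero power2_abs)
    \<comment> \<open>Subtracting the two sphere equations leaves a linear condition on
      \<open>y\<close>. With the norm of \<open>y\<close> known, it is the equality case of
      Cauchy-Schwarz, so \<open>y\<close> is a multiple of \<open>n\<close>.\<close>
    also have "\<dots> \<longleftrightarrow> y \<bullet> y = d\<^sup>2 \<and> y \<bullet> n = d * \<delta>"
      by (auto simp: power2_norm_eq_inner inner_diff_left inner_diff_right inner_commute[of n y] n)
        (auto simp: \<delta>_def power2_eq_square algebra_simps)
    also have "\<dots> \<longleftrightarrow> y = p"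
    proof
      assume "y \<bullet> y = d\<^sup>2 \<and> y \<bullet> n = d * \<delta>"
      then have "(y - p) \<bullet> (y - p) = 0"
        using \<delta> by (simp add: p_def inner_diff_left inner_diff_right inner_commute[of n y] n)
          (simp add: power2_eq_square)
      then show "y = p" by simp
    next
      assume "y = p"
      then show "y \<bullet> y = d\<^sup>2 \<and> y \<bullet> n = d * \<delta>"
        using \<delta> by (simp add: p_def n) (simp add: power2_eq_square)
    qed
    also have "\<dots> \<longleftrightarrow> x = c + p" by (auto simp: y_def algebra_simps)
    finally show ?thesis .
  qed
  then have "sphere c \<bar>d\<bar> \<inter> sphere c' \<bar>d'\<bar> = {c + p}" by blast
  then show ?thesis by (simp add: spheres_touch_def is_singleton_def)
qed

text \<open>Hypothesis \<open>pe\<close> is the vanishing of the discriminant when the line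
  \<open>p + t *\<^sub>R e\<close> is intersected with the sphere. The line is given by
  \<open>e\<close> instead of \<open>q - p\<close>, so that coinciding end points
  (\<open>k = 0\<close>) are covered.\<close>

lemma edge_touches_sphereI:
  assumes e: "e \<noteq> 0" and q: "q = p + k *\<^sub>R e" and r: "r > 0"
    and pe: "(p \<bullet> e)\<^sup>2 = ((norm p)\<^sup>2 - r\<^sup>2) * (norm e)\<^sup>2"
  shows "edge_touches_sphere p q r"
proof -
  define L where "L = (+) p ` span {e}"
  have mem: "x \<in> L \<longleftrightarrow> (\<exists>t. x = p + t *\<^sub>R e)" for x
    by (auto simp: L_def span_singleton)
  have "affine L" by (simp add: L_def affine_translation[symmetric] subspace_imp_affine)
  moreover have "aff_dim L = 1"
    using e by (simp add: L_def aff_dim_translation_eq aff_dim_subspace)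
  moreover have "p \<in> L" "q \<in> L" unfolding mem q by (auto intro: exI[of _ 0])
  moreover have "is_singleton (L \<inter> sphere 0 r)"
  proof -
    have ee: "e \<bullet> e > 0" using e by simp
    define t0 where "t0 = - (p \<bullet> e) / (e \<bullet> e)"
    have "p + t *\<^sub>R e \<in> sphere 0 r \<longleftrightarrow> t = t0" for t
    proof -
      have "p + t *\<^sub>R e \<in> sphere 0 r \<longleftrightarrow> (norm (p + t *\<^sub>R e))\<^sup>2 = r\<^sup>2"
        using r by (simp add: power2_eq_iff_nonneg)
      also have "\<dots> \<longleftrightarrow> p \<bullet> p + 2 * t * (p \<bullet> e) + t\<^sup>2 * (e \<bullet> e) - r\<^sup>2 = 0"
        unfolding power2_norm_eq_inner
        by (auto simp: inner_add_left inner_add_right inner_commute[of e p]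
            power2_eq_square algebra_simps)
      \<comment> \<open>By \<open>pe\<close>, the factor \<open>e \<bullet> e\<close> turns the
        quadratic in \<open>t\<close> into a perfect square.\<close>
      also have "\<dots> \<longleftrightarrow> (p \<bullet> p + 2 * t * (p \<bullet> e) + t\<^sup>2 * (e \<bullet> e) - r\<^sup>2) * (e \<bullet> e) = 0"
        using ee by simp
      also have "(p \<bullet> p + 2 * t * (p \<bullet> e) + t\<^sup>2 * (e \<bullet> e) - r\<^sup>2) * (e \<bullet> e) = (t * (e \<bullet> e) + p \<bullet> e)\<^sup>2"
        using pe unfolding power2_norm_eq_inner by (simp add: power2_eq_square algebra_simps)
      also have "\<dots> = 0 \<longleftrightarrow> t = t0"
        using ee by (auto simp: t0_def field_simps eq_neg_iff_add_eq_0)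
      finally show ?thesis .
    qed
    note t0 = this
    have "L \<inter> sphere 0 r = {x. \<exists>t. x = p + t *\<^sub>R e \<and> p + t *\<^sub>R e \<in> sphere 0 r}"
      by (rule set_eqI) (unfold Int_iff mem mem_Collect_eq, blast)
    also have "\<dots> = {p + t0 *\<^sub>R e}" unfolding t0 by simp
    finally have "L \<inter> sphere 0 r = {p + t0 *\<^sub>R e}" .
    then show ?thesis by (simp add: is_singleton_def)
  qed
  ultimately show ?thesis unfolding edge_touches_sphere_def by blast
qed

section \<open>Edges of Christoffel and Darboux transforms\<close>

text \<open>The \<open>e_zero\<close> components give
  \<open>(d * d' - \<nu>) * (d' - a * d) = 0\<close>. In the generic case \<open>a = d' / d\<close>
  the centers force \<open>\<mu> = - \<nu>\<close> and the \<open>e_inf\<close> components give the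
  last claim; the degenerate case \<open>d * d' = \<nu>\<close> is treated by the centers
  alone.\<close>

lemma Christoffel_Darboux_edge:
  fixes s s' t t' :: osphere
  defines "e \<equiv> center s' - center s"
    and "n \<equiv> center t - center s" and "n' \<equiv> center t' - center s'"
    and "d \<equiv> radius s" and "d' \<equiv> radius s'"
  assumes D: "lift t' - lift s = a *\<^sub>R (lift t - lift s')"
    and C: "center t' - center t = (\<mu> / (d * d')) *\<^sub>R e"
    and r: "d * radius t = \<nu>" "d' * radius t' = \<nu>" and \<mu>: "\<bar>\<nu>\<bar> = \<bar>\<mu>\<bar>"
    and nz: "\<nu> \<noteq> 0" "e \<noteq> 0"
  shows "\<mu> = \<nu> \<Longrightarrow> n' = n"
    and "\<mu> = - \<nu> \<Longrightarrow> n' - n = - (1 + \<nu> / (d * d')) *\<^sub>R e"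
    and "\<mu> = - \<nu> \<Longrightarrow> e \<bullet> (n + n') = (d\<^sup>2 - d'\<^sup>2) * (1 - \<nu> / (d * d'))"
proof -
  have d: "d \<noteq> 0" "d' \<noteq> 0" using r nz by auto
  have rt: "radius t = \<nu> / d" "radius t' = \<nu> / d'" using r d by (auto simp: field_simps)
  have nn: "n' - n = (\<mu> / (d * d') - 1) *\<^sub>R e"
    using C by (simp add: n_def n'_def e_def algebra_simps)
  note cmp = lift_components[OF D, unfolded rt, folded d_def d'_def]
  have c1: "(d' / \<nu>) *\<^sub>R center t' - (1 / d) *\<^sub>R center s =
      a *\<^sub>R ((d / \<nu>) *\<^sub>R center t - (1 / d') *\<^sub>R center s')"
    using cmp(1) d nz by (simp add: inverse_eq_divide)
  have "d' / \<nu> - 1 / d = a * (d / \<nu> - 1 / d')" using cmp(2) by simp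
  then have "\<nu> * d * d' * (d' / \<nu> - 1 / d) = a * (\<nu> * d * d' * (d / \<nu> - 1 / d'))" by simp
  moreover have "\<nu> * d * d' * (d' / \<nu> - 1 / d) = d' * (d * d' - \<nu>)"
    and "\<nu> * d * d' * (d / \<nu> - 1 / d') = d * (d * d' - \<nu>)"
    using d nz by (simp_all add: right_diff_distrib)
  ultimately have "d' * (d * d' - \<nu>) = a * (d * (d * d' - \<nu>))" by (simp only:)
  then have "(d * d' - \<nu>) * (d' - a * d) = 0" by (simp add: algebra_simps)
  then have "d * d' - \<nu> = 0 \<or> d' - a * d = 0" by (simp only: mult_eq_0_iff)
  then have cases: "d * d' = \<nu> \<or> a = d' / d" using d by (auto simp: field_simps)
  have \<mu>1: "\<mu> = - \<nu>" if a: "a = d' / d"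
  proof -
    \<comment> \<open>The factor \<open>d / d'\<close> cancels \<open>a\<close>, so that the
      coefficients on both sides agree and only differences of centers remain.\<close>
    have "(d / d') *\<^sub>R ((d' / \<nu>) *\<^sub>R center t' - (1 / d) *\<^sub>R center s) =
      (d / d') *\<^sub>R (a *\<^sub>R ((d / \<nu>) *\<^sub>R center t - (1 / d') *\<^sub>R center s'))"
      using c1 by simp
    then have "(d / \<nu>) *\<^sub>R center t' - (1 / d') *\<^sub>R center s =
        (d / \<nu>) *\<^sub>R center t - (1 / d') *\<^sub>R center s'"
      using d a by (simp add: scaleR_diff_right)
    then have "(d / \<nu>) *\<^sub>R (center t' - center t) = - (1 / d') *\<^sub>R e"
      by (simp add: e_def algebra_simps)
    then have "(\<mu> / (\<nu> * d') + 1 / d') *\<^sub>R e = 0"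
      unfolding C using d by (simp add: scaleR_add_left)
    then have "\<mu> / (\<nu> * d') + 1 / d' = 0" using nz by simp
    then show "\<mu> = - \<nu>" using d nz by (simp add: field_simps)
  qed
  show "n' = n" if "\<mu> = \<nu>"
  proof -
    have "d * d' = \<nu>" using cases \<mu>1 that nz by auto
    then show ?thesis using nn that nz by simp
  qed
  show nn2: "n' - n = - (1 + \<nu> / (d * d')) *\<^sub>R e" if "\<mu> = - \<nu>"
    using nn that by (simp add: algebra_simps)
  show "e \<bullet> (n + n') = (d\<^sup>2 - d'\<^sup>2) * (1 - \<nu> / (d * d'))" if m: "\<mu> = - \<nu>"
  proof (cases "a = d' / d")
    case True
    define P where "P = (norm (center t))\<^sup>2"
    define P' where "P' = (norm (center t'))\<^sup>2"
    define Q where "Q = (norm (center s))\<^sup>2"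
    define Q' where "Q' = (norm (center s'))\<^sup>2"
    \<comment> \<open>Factoring the difference of squares lets the Christoffel relation replace
      \<open>center t' - center t\<close> by a multiple of \<open>e\<close>.\<close>
    have "P' - P = (center t' - center t) \<bullet> (center t' + center t)"
      by (simp add: P_def P'_def power2_norm_eq_inner algebra_simps inner_commute)
    then have P: "P' - P = - (\<nu> / (d * d')) * (e \<bullet> (center t' + center t))"
      using C m by simp
    have Q: "Q' - Q = e \<bullet> (center s' + center s)"
      by (simp add: Q_def Q'_def e_def power2_norm_eq_inner algebra_simps inner_commute)
    have "(P' - (\<nu> / d')\<^sup>2) / (\<nu> / d') - (Q - d\<^sup>2) / d =
        d' / d * ((P - (\<nu> / d)\<^sup>2) / (\<nu> / d) - (Q' - d'\<^sup>2) / d')"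
      using cmp(3) True by (simp add: P_def P'_def Q_def Q'_def)
    then have "d * ((P' - (\<nu> / d')\<^sup>2) / (\<nu> / d') - (Q - d\<^sup>2) / d) =
        d * (d' / d * ((P - (\<nu> / d)\<^sup>2) / (\<nu> / d) - (Q' - d'\<^sup>2) / d'))"
      by (rule arg_cong)
    moreover have "d * ((P' - (\<nu> / d')\<^sup>2) / (\<nu> / d') - (Q - d\<^sup>2) / d) =
        d * d' / \<nu> * P' - \<nu> * d / d' - Q + d\<^sup>2"
      using d nz(1) by (simp add: field_simps power2_eq_square)
    moreover have "d * (d' / d * ((P - (\<nu> / d)\<^sup>2) / (\<nu> / d) - (Q' - d'\<^sup>2) / d')) =
        d * d' / \<nu> * P - \<nu> * d' / d - Q' + d'\<^sup>2"
      using d nz(1) by (simp add: field_simps power2_eq_square)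
    ultimately have "d * d' / \<nu> * P' - \<nu> * d / d' - Q + d\<^sup>2 =
        d * d' / \<nu> * P - \<nu> * d' / d - Q' + d'\<^sup>2"
      by (simp only:)
    moreover have "(d'\<^sup>2 - d\<^sup>2) * (\<nu> / (d * d')) = \<nu> * d' / d - \<nu> * d / d'"
      using d by (simp add: field_simps power2_eq_square)
    ultimately have "d * d' / \<nu> * (P' - P) + (Q' - Q) = (d'\<^sup>2 - d\<^sup>2) * (1 - \<nu> / (d * d'))"
      by (simp add: right_diff_distrib)
    moreover have "d * d' / \<nu> * (P' - P) = - (e \<bullet> (center t' + center t))"
      unfolding P using d nz by simp
    moreover have "e \<bullet> (n + n') = e \<bullet> (center t' + center t) - e \<bullet> (center s' + center s)"
      by (simp add: n_def n'_def inner_simps)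
    ultimately show ?thesis unfolding Q by (simp add: algebra_simps)
  next
    case False
    \<comment> \<open>Here both sides of the claim vanish: the right one by its second factor, the
      left one because \<open>n + n' = 2 *\<^sub>R w\<close> and the centers give
      \<open>w = 0\<close>.\<close>
    then have dd: "d * d' = \<nu>" using cases by simp
    have tt: "center t' = center t - e" using C dd m nz by (simp add: algebra_simps)
    define w where "w = center t - center s'"
    have "d' / \<nu> = 1 / d" "d / \<nu> = 1 / d'" using dd d by (auto simp: field_simps)
    then have "(1 / d) *\<^sub>R (center t' - center s) = (a / d') *\<^sub>R w"
      using c1 by (simp add: w_def scaleR_diff_right)
    moreover have "center t' - center s = w" by (simp add: tt w_def e_def)
    ultimately have "(1 / d - a / d') *\<^sub>R w = 0" by (simp add: scaleR_diff_left)
    moreover have "1 / d - a / d' \<noteq> 0" using False d by (auto simp: field_simps)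
    ultimately have "w = 0" by simp
    moreover have "n + n' = 2 *\<^sub>R w"
      by (simp add: n_def n'_def tt w_def e_def scaleR_2)
    ultimately show ?thesis using dd nz(1) by simp
  qed
qed

text \<open>
  The sign \<open>\<sigma>\<close> treats horizontal (\<open>\<sigma> = 1\<close>) and vertical (\<open>\<sigma> = - 1\<close>) edges alike.
\<close>

lemma edge_inner_square:
  fixes e n n' :: "'a::real_inner"
  assumes "n' - n = - (1 + \<nu> / (d * d')) *\<^sub>R e"
    and "e \<bullet> (n + n') = (d\<^sup>2 - d'\<^sup>2) * (1 - \<nu> / (d * d'))"
    and "(norm e)\<^sup>2 = (d + \<sigma> * d')\<^sup>2" "\<sigma>\<^sup>2 = 1" "d \<noteq> 0" "d' \<noteq> 0"
  shows "(norm n')\<^sup>2 - (norm n)\<^sup>2 = d'\<^sup>2 + (\<nu> / d')\<^sup>2 - (d\<^sup>2 + (\<nu> / d)\<^sup>2)"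
    and "(n \<bullet> e)\<^sup>2 = (d + \<sigma> * (\<nu> / d))\<^sup>2 * (norm e)\<^sup>2"
proof -
  define k where "k = \<nu> / (d * d')"
  \<comment> \<open>The first hypothesis makes \<open>n' - n\<close> a multiple of \<open>e\<close>,
    and the second one evaluates the product of \<open>e\<close> with \<open>n + n'\<close>.\<close>
  have "(norm n')\<^sup>2 - (norm n)\<^sup>2 = (n' - n) \<bullet> (n + n')"
    by (simp add: power2_norm_eq_inner algebra_simps inner_commute)
  also have "\<dots> = - (1 + k) * ((d\<^sup>2 - d'\<^sup>2) * (1 - k))"
    using assms(1,2) by (simp add: k_def)
  also have "\<dots> = (d'\<^sup>2 - d\<^sup>2) * (1 - k\<^sup>2)"
    by (simp add: algebra_simps power2_eq_square)
  also have "\<dots> = d'\<^sup>2 + (\<nu> / d')\<^sup>2 - (d\<^sup>2 + (\<nu> / d)\<^sup>2)"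
    using assms(5,6) by (simp add: k_def field_simps power2_eq_square)
  finally show "(norm n')\<^sup>2 - (norm n)\<^sup>2 = d'\<^sup>2 + (\<nu> / d')\<^sup>2 - (d\<^sup>2 + (\<nu> / d)\<^sup>2)" .
  have en: "e \<bullet> (n' - n) = - (1 + k) * (norm e)\<^sup>2"
    unfolding assms(1) k_def by (simp only: inner_scaleR_right power2_norm_eq_inner)
  have "2 * (n \<bullet> e) = e \<bullet> (n + n') - e \<bullet> (n' - n)"
    by (simp add: algebra_simps inner_commute)
  also have "\<dots> = (d\<^sup>2 - d'\<^sup>2) * (1 - k) + (1 + k) * (d + \<sigma> * d')\<^sup>2"
    unfolding en assms(2,3) k_def by (simp only: mult_minus_left diff_minus_eq_add)
  \<comment> \<open>As \<open>\<sigma>\<close> is a sign, the difference \<open>d^2 - d'^2\<close>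
    splits off the factor \<open>d + \<sigma> * d'\<close>, whose square is the squared length of
    \<open>e\<close>.\<close>
  also have "\<dots> = 2 * ((d + \<sigma> * d') * (d + k * \<sigma> * d'))"
    using assms(4) by algebra
  finally have "n \<bullet> e = (d + \<sigma> * d') * (d + k * \<sigma> * d')" by linarith
  moreover have "k * \<sigma> * d' = \<sigma> * (\<nu> / d)" using assms(5,6) by (simp add: k_def)
  ultimately have "n \<bullet> e = (d + \<sigma> * d') * (d + \<sigma> * (\<nu> / d))" by simp
  then show "(n \<bullet> e)\<^sup>2 = (d + \<sigma> * (\<nu> / d))\<^sup>2 * (norm e)\<^sup>2"
    using assms(3) by (simp add: power_mult_distrib)
qed

section \<open>Quad graphs\<close>

lemma vertex_of_flip:
  assumes "cell_decomposition G" "x \<in> flags G"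
  shows "vertex_of G (flip_edge G x) = vertex_of G x"
    and "vertex_of G (flip_face G x) = vertex_of G x"
proof -
  have "flip_edge G x \<in> vertex_orbit G x" "flip_face G x \<in> vertex_orbit G x"
    by (auto simp: vertex_orbit_def flip_orbit_def intro!: r_into_rtrancl)
  moreover have "flip_edge G x \<in> flags G" "flip_face G x \<in> flags G"
    using assms by (auto simp: cell_decomposition_def)
  ultimately show "vertex_of G (flip_edge G x) = vertex_of G x"
    and "vertex_of G (flip_face G x) = vertex_of G x"
    using assms unfolding cell_decomposition_def by metis+
qed

text \<open>The surface is connected: any two flags are joined by flips, and only
  \<open>flip_vertex\<close> changes the vertex, moving it along an edge.\<close>

lemma constant_on_verts:
  assumes G: "cell_decomposition G"
    and edge: "\<And>x. x \<in> flags G \<Longrightarrow> g (edge_end G x) = g (vertex_of G x)"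
  shows "g constant_on verts G"
proof -
  obtain x where x: "x \<in> flags G" using G by (auto simp: cell_decomposition_def)
  have "y \<in> flags G \<and> g (vertex_of G y) = g (vertex_of G x)" if "y \<in> flags G" for y
  proof -
    have "(x, y) \<in> {(z, t z) |z t. t \<in> {flip_vertex G, flip_edge G, flip_face G}}\<^sup>*"
      using G x that unfolding cell_decomposition_def flip_orbit_def by blast
    then show ?thesis
    proof (induction rule: rtrancl_induct)
      case base
      then show ?case using x by simp
    next
      case (step y z)
      then have y: "y \<in> flags G" by blast
      then have "flip_vertex G y \<in> flags G" "flip_edge G y \<in> flags G" "flip_face G y \<in> flags G"
        using G by (auto simp: cell_decomposition_def)
      with step edge[OF y, unfolded edge_end_def] vertex_of_flip[OF G y] show ?case by auto
    qed
  qed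
  then show ?thesis unfolding constant_on_def verts_def by blast
qed

text \<open>Four steps around a face close up, so two steps in either direction reach the same
  vertex. This transfers statements from horizontal to vertical flags.\<close>

lemma opposite_flip_edge:
  assumes "quad_graph G" "x \<in> flags G"
  shows "opposite G (flip_edge G x) = opposite G x"
proof -
  have G: "cell_decomposition G" using assms by (simp add: quad_graph_def)
  let ?e = "flip_edge G" and ?f = "flip_vertex G"
  have inv: "?e y \<in> flags G \<and> ?e (?e y) = y \<and> ?f y \<in> flags G \<and> ?f (?f y) = y"
    if "y \<in> flags G" for y
    using G that by (simp add: cell_decomposition_def)
  have "?e (?f (?e (?f (?e (?f (?e (?f x))))))) = x"
    using assms unfolding quad_graph_def by (auto simp: eval_nat_numeral)
  then have "?f (?e (?f (?e (?e (?f (?e (?f (?e (?f (?e (?f x))))))))))) = ?f (?e (?f (?e x)))"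
    by simp
  then have "?e (?f (?e (?f x))) = ?f (?e (?f (?e x)))"
    using inv assms(2) by simp
  moreover have "vertex_of G (?e (?f (?e (?f x)))) = vertex_of G (?f (?e (?f x)))"
    using inv assms(2) by (intro vertex_of_flip[OF G]) blast
  ultimately show ?thesis by (simp add: opposite_def edge_end_def)
qed

text \<open>This is planarity of the faces of the center net: the linear relation between the lifts
  is an affine relation between the centers, weighted by the inverse radii.\<close>

lemma S_isothermic_face:
  assumes G: "quad_graph G" and s: "S_isothermic G s" and x: "x \<in> flags G"
  defines "c \<equiv> \<lambda>v. center (s v)"
  shows "c (opposite G x) - c (vertex_of G x) \<in>
    span {c (edge_end G x) - c (vertex_of G x),
          c (edge_end G (flip_edge G x)) - c (vertex_of G x)}"
proof -
  have cell: "cell_decomposition G" using G by (simp add: quad_graph_def)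
  have *: "c (opposite G x) - c (vertex_of G x) \<in>
    span {c (edge_end G x) - c (vertex_of G x),
          c (edge_end G (flip_edge G x)) - c (vertex_of G x)}"
    if x: "x \<in> flags G" and h: "horizontal G x" for x
  proof -
    obtain a where a: "lift (s (opposite G x)) - lift (s (vertex_of G x)) =
             a *\<^sub>R (lift (s (edge_end G (flip_edge G x))) - lift (s (edge_end G x)))"
      using s x h unfolding S_isothermic_def by blast
    define r where "r v = radius (s v)" for v
    let ?v = "vertex_of G x" and ?i = "edge_end G x" and ?j = "edge_end G (flip_edge G x)"
      and ?o = "opposite G x"
    have "?o \<in> verts G" using cell x
      by (auto simp: verts_def opposite_def edge_end_def cell_decomposition_def)
    then have ro: "r ?o \<noteq> 0" using s by (auto simp: S_isothermic_def r_def)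
    have 1: "c ?o /\<^sub>R r ?o - c ?v /\<^sub>R r ?v = a *\<^sub>R (c ?j /\<^sub>R r ?j - c ?i /\<^sub>R r ?i)"
      and 2: "inverse (r ?o) - inverse (r ?v) = a * (inverse (r ?j) - inverse (r ?i))"
      using lift_components(1,2)[OF a] by (simp_all add: r_def c_def inverse_eq_divide)
    \<comment> \<open>Subtracting the \<open>e_zero\<close> relation times \<open>c ?v\<close> from
      the relation of the centers moves the origin to \<open>c ?v\<close>.\<close>
    have "(c ?o - c ?v) /\<^sub>R r ?o =
        (c ?o /\<^sub>R r ?o - c ?v /\<^sub>R r ?v) - (inverse (r ?o) - inverse (r ?v)) *\<^sub>R c ?v"
      by (simp add: algebra_simps)
    also have "\<dots> = a *\<^sub>R ((c ?j - c ?v) /\<^sub>R r ?j - (c ?i - c ?v) /\<^sub>R r ?i)"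
      unfolding 1 2 by (simp add: algebra_simps)
    finally have "c ?o - c ?v = r ?o *\<^sub>R a *\<^sub>R ((c ?j - c ?v) /\<^sub>R r ?j - (c ?i - c ?v) /\<^sub>R r ?i)"
      using ro by (metis scaleR_one scaleR_scaleR right_inverse)
    then show ?thesis
      by (simp only:) (intro span_mul span_diff[OF span_mul span_mul] span_base; simp)
  qed
  show ?thesis
  proof (cases "horizontal G x")
    case True
    then show ?thesis using * x by blast
  next
    case False
    then have "horizontal G (flip_edge G x)" "flip_edge G x \<in> flags G" "flip_edge G (flip_edge G x) = x"
      using G cell x by (auto simp: quad_graph_def cell_decomposition_def)
    then show ?thesis
      using *[of "flip_edge G x"] opposite_flip_edge[OF G x] vertex_of_flip[OF cell x]
      by (simp add: insert_commute)
  qed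
qed

text \<open>Each face of \<open>k\<close> lies in a translate of the direction space of the
  corresponding face of centers. Edges of \<open>k\<close> may degenerate to points.\<close>

lemma Q_net_parallel:
  fixes k :: "'v \<Rightarrow> real^3"
  assumes G: "quad_graph G" and s: "S_isothermic G s"
    and edge: "\<And>x. x \<in> flags G \<Longrightarrow> \<exists>a. k (edge_end G x) - k (vertex_of G x) =
      a *\<^sub>R (center (s (edge_end G x)) - center (s (vertex_of G x)))"
  shows "Q_net G k"
  unfolding Q_net_def
proof
  fix x assume x: "x \<in> flags G"
  have cell: "cell_decomposition G" using G by (simp add: quad_graph_def)
  define c where "c v = center (s v)" for v
  define v where "v = vertex_of G x"
  define i where "i = edge_end G x"
  define j where "j = edge_end G (flip_edge G x)"
  define w where "w = opposite G x"
  define V where "V = span {c i - c v, c j - c v}"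
  have y: "flip_vertex G x \<in> flags G" "flip_edge G x \<in> flags G"
    "flip_edge G (flip_vertex G x) \<in> flags G"
    using cell x by (auto simp: cell_decomposition_def)
  have V: "c i - c v \<in> V" "c j - c v \<in> V" by (auto simp: V_def intro: span_base)
  have "c w - c v \<in> V"
    using S_isothermic_face[OF G s x] by (simp add: V_def c_def v_def i_def j_def w_def)
  then have V': "c w - c i \<in> V"
    using span_diff[of "c w - c v" _ "c i - c v"] V by (simp add: V_def)
  obtain a1 where "k i - k v = a1 *\<^sub>R (c i - c v)"
    using edge[OF x] by (auto simp: c_def v_def i_def)
  then have 1: "k i - k v \<in> V" using V by (simp add: V_def span_mul)
  obtain a2 where "k j - k v = a2 *\<^sub>R (c j - c v)"
    using edge[OF y(2)] vertex_of_flip[OF cell x] by (auto simp: c_def v_def j_def)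
  then have 2: "k j - k v \<in> V" using V by (simp add: V_def span_mul)
  obtain a3 where "k w - k i = a3 *\<^sub>R (c w - c i)"
    using edge[OF y(3)] vertex_of_flip[OF cell y(1)]
    by (auto simp: c_def w_def i_def opposite_def edge_end_def)
  then have "k w - k i \<in> V" using V' by (simp add: V_def span_mul)
  then have 3: "k w - k v \<in> V"
    using span_add[of "k w - k i" _ "k i - k v"] 1 by (simp add: V_def)
  have mem: "z \<in> (+) (k v) ` V" if "z - k v \<in> V" for z
    using that by (metis image_eqI add_diff_cancel_left' diff_add_cancel add.commute)
  moreover have "k v - k v \<in> V" by (simp add: V_def span_zero)
  ultimately have "{k v, k i, k w, k j} \<subseteq> (+) (k v) ` V" using 1 2 3 by blast
  then have "aff_dim {k v, k i, k w, k j} \<le> aff_dim ((+) (k v) ` V)" by (rule aff_dim_subset)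
  also have "\<dots> = int (dim V)"
    by (simp add: aff_dim_translation_eq V_def aff_dim_subspace)
  also have "\<dots> \<le> 2"
    using dim_le_card'[of "{c i - c v, c j - c v}"] card_insert_le_m1[of 2 "{c j - c v}" "c i - c v"]
    by (simp add: V_def dim_span)
  finally show "aff_dim {k (vertex_of G x), k (edge_end G x), k (opposite G x),
                 k (edge_end G (flip_edge G x))} \<le> 2"
    by (simp add: v_def i_def w_def j_def)
qed

section \<open>The Gauss map\<close>

theorem theorem3p6:
  fixes G :: "('f, 'v) quad_map"
    and s sd :: "'v \<Rightarrow> osphere"
  assumes "quad_graph G"
    and "S1_cmc_pair G s sd"
    and "\<not> gauss_map s sd constant_on verts G"
    and "\<forall>v\<in>verts G. \<not> spheres_touch (s v) (sd v)"
  shows "\<exists>\<rho>>0. two_sphere_Koebe_net G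
           (gauss_map (scale_sphere \<rho> \<circ> s) (scale_sphere \<rho> \<circ> sd))"
proof -
  have cell: "cell_decomposition G" using assms(1) by (simp add: quad_graph_def)
  have iso: "S_isothermic G s" "S1_isothermic G s"
    and Chr: "Christoffel_dual G s sd" and Dar: "Darboux_pair G s sd"
    using assms(2) by (auto simp: S1_cmc_pair_def S_cmc_pair_def S1_isothermic_def)
  obtain \<mu> \<nu> where \<mu>: "\<mu> \<noteq> 0" "\<bar>\<nu>\<bar> = \<bar>\<mu>\<bar>"
    and cd: "\<And>x. x \<in> flags G \<Longrightarrow> center (sd (edge_end G x)) - center (sd (vertex_of G x)) =
             (\<mu> / (radius (s (vertex_of G x)) * radius (s (edge_end G x)))) *\<^sub>R
               (center (s (edge_end G x)) - center (s (vertex_of G x)))"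
    and rd: "\<And>v. v \<in> verts G \<Longrightarrow> radius (s v) * radius (sd v) = \<nu>"
    using Chr unfolding Christoffel_dual_def by blast
  have \<nu>: "\<nu> \<noteq> 0" using \<mu> by auto
  define n where "n = gauss_map s sd"
  define d where "d v = radius (s v)" for v
  define e where "e x = center (s (edge_end G x)) - center (s (vertex_of G x))" for x
  have n: "n v = center (sd v) - center (s v)" for v by (simp add: n_def gauss_map_def)
  have vx: "vertex_of G x \<in> verts G" "edge_end G x \<in> verts G" if "x \<in> flags G" for x
    using cell that by (auto simp: verts_def edge_end_def cell_decomposition_def)
  have d0: "d v \<noteq> 0" if "v \<in> verts G" for v using rd[OF that] \<nu> by (auto simp: d_def)
  have e0: "e x \<noteq> 0" if "x \<in> flags G" for x
    using spheres_touch_imp_center_neq[of "s (vertex_of G x)" "s (edge_end G x)"] iso(2) that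
      d0[OF vx(1)[OF that]] by (auto simp: S1_isothermic_def e_def d_def)
  have edge: "\<mu> = \<nu> \<Longrightarrow> n (edge_end G x) = n (vertex_of G x)"
    "\<mu> = - \<nu> \<Longrightarrow> n (edge_end G x) - n (vertex_of G x) =
      - (1 + \<nu> / (d (vertex_of G x) * d (edge_end G x))) *\<^sub>R e x"
    "\<mu> = - \<nu> \<Longrightarrow> e x \<bullet> (n (vertex_of G x) + n (edge_end G x)) =
      ((d (vertex_of G x))\<^sup>2 - (d (edge_end G x))\<^sup>2) *
      (1 - \<nu> / (d (vertex_of G x) * d (edge_end G x)))" if x: "x \<in> flags G" for x
  proof -
    obtain a where a: "lift (sd (edge_end G x)) - lift (s (vertex_of G x)) =
          a *\<^sub>R (lift (sd (vertex_of G x)) - lift (s (edge_end G x)))"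
      using Dar x unfolding Darboux_pair_def by blast
    note E = Christoffel_Darboux_edge[OF a cd[OF x] rd[OF vx(1)[OF x]] rd[OF vx(2)[OF x]]
        \<mu>(2) \<nu> e0[OF x, unfolded e_def]]
    show "\<mu> = \<nu> \<Longrightarrow> n (edge_end G x) = n (vertex_of G x)"
      "\<mu> = - \<nu> \<Longrightarrow> n (edge_end G x) - n (vertex_of G x) =
        - (1 + \<nu> / (d (vertex_of G x) * d (edge_end G x))) *\<^sub>R e x"
      "\<mu> = - \<nu> \<Longrightarrow> e x \<bullet> (n (vertex_of G x) + n (edge_end G x)) =
        ((d (vertex_of G x))\<^sup>2 - (d (edge_end G x))\<^sup>2) *
        (1 - \<nu> / (d (vertex_of G x) * d (edge_end G x)))"
      using E unfolding n d_def e_def by blast+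
  qed
  have not_const: "\<not> n constant_on verts G" using assms(3) by (simp add: n_def)
  \<comment> \<open>Otherwise \<open>n\<close> would agree at the ends of every edge and hence be
    constant.\<close>
  have "\<mu> \<noteq> \<nu>" using constant_on_verts[OF cell, of n] edge(1) not_const by blast
  then have \<mu>\<nu>: "\<mu> = - \<nu>" using \<mu>(2) by linarith
  define \<sigma> :: "'f \<Rightarrow> real" where "\<sigma> x = (if horizontal G x then 1 else - 1)" for x
  have \<sigma>: "(\<sigma> x)\<^sup>2 = 1" for x by (simp add: \<sigma>_def)
  have norm_e: "(norm (e x))\<^sup>2 = (d (vertex_of G x) + \<sigma> x * d (edge_end G x))\<^sup>2"
    if x: "x \<in> flags G" for x
  proof -
    have "lorentz (lift (s (vertex_of G x))) (lift (s (edge_end G x))) = - \<sigma> x"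
      using iso(2) x by (simp add: S1_isothermic_def \<sigma>_def)
    then have "- 2 * \<sigma> x * d (vertex_of G x) * d (edge_end G x) =
        (d (vertex_of G x))\<^sup>2 + (d (edge_end G x))\<^sup>2 - (norm (e x))\<^sup>2"
      using lorentz_lift[of "s (vertex_of G x)" "s (edge_end G x)"] d0[OF vx(1)[OF x]]
        d0[OF vx(2)[OF x]] by (simp add: d_def e_def algebra_simps)
    then show ?thesis using \<sigma>[of x] by algebra
  qed
  note sq = edge_inner_square[OF edge(2,3)[OF _ \<mu>\<nu>] norm_e \<sigma> d0[OF vx(1)] d0[OF vx(2)]]
  define g where "g v = (norm (n v))\<^sup>2 - (d v)\<^sup>2 - (\<nu> / d v)\<^sup>2" for v
  have "g constant_on verts G"
    using sq(1) by (intro constant_on_verts[OF cell]) (simp add: g_def algebra_simps)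
  then obtain C where C: "\<And>v. v \<in> verts G \<Longrightarrow> g v = C" by (auto simp: constant_on_def)
  have nC: "(norm (n v))\<^sup>2 - (d v + t * (\<nu> / d v))\<^sup>2 = C - 2 * \<nu> * t"
    if "v \<in> verts G" "t\<^sup>2 = 1" for v t
  proof -
    have "(d v + t * (\<nu> / d v))\<^sup>2 = (d v)\<^sup>2 + 2 * \<nu> * t + t\<^sup>2 * (\<nu> / d v)\<^sup>2"
      using d0[OF that(1)] by (simp add: power2_eq_square field_simps)
    then show ?thesis using C[OF that(1)] that(2) by (simp add: g_def)
  qed
  have sq2: "(n (vertex_of G x) \<bullet> e x)\<^sup>2 =
      ((norm (n (vertex_of G x)))\<^sup>2 - (C - 2 * \<nu> * \<sigma> x)) * (norm (e x))\<^sup>2"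
    if x: "x \<in> flags G" for x
    using sq(2)[OF x x x x x] nC[OF vx(1)[OF x] \<sigma>[of x]] by (simp add: algebra_simps)
  have neq: "C - 2 * \<nu> * t \<noteq> 0" if t: "t\<^sup>2 = 1" for t
  proof
    assume 0: "C - 2 * \<nu> * t = 0"
    have "n v = 0" if v: "v \<in> verts G" for v
    proof (rule ccontr)
      assume "n v \<noteq> 0"
      have "radius (sd v) = \<nu> / d v" using rd[OF v] d0[OF v] by (simp add: d_def field_simps)
      then have "(norm (n v))\<^sup>2 = (d v + t * radius (sd v))\<^sup>2" using nC[OF v t] 0 by simp
      \<comment> \<open>For \<open>t = - 1\<close> this reverses the orientation of
        \<open>sd v\<close>, which leaves the underlying sphere and hence the contact
        unchanged.\<close>
      then have "spheres_touch (s v) (center (sd v), t * radius (sd v))"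
        using \<open>n v \<noteq> 0\<close> by (intro spheres_touchI) (auto simp: n d_def)
      moreover have "\<bar>t\<bar> = 1" using t by (simp add: abs_square_eq_1)
      ultimately have "spheres_touch (s v) (sd v)"
        by (simp add: spheres_touch_def abs_mult)
      then show False using assms(4) v by blast
    qed
    then show False using not_const by (auto simp: constant_on_def)
  qed
  have pos: "C - 2 * \<nu> * \<sigma> x > 0" if x: "x \<in> flags G" for x
  proof -
    \<comment> \<open>Cauchy-Schwarz makes the squared distance of the edge line from the origin
      nonnegative; \<open>neq\<close> excludes zero.\<close>
    have "(n (vertex_of G x) \<bullet> e x)\<^sup>2 \<le> (norm (n (vertex_of G x)))\<^sup>2 * (norm (e x))\<^sup>2"
      by (simp add: power2_norm_eq_inner Cauchy_Schwarz_ineq)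
    then have "0 \<le> (C - 2 * \<nu> * \<sigma> x) * (norm (e x))\<^sup>2" using sq2[OF x] by (simp add: algebra_simps)
    then have "C - 2 * \<nu> * \<sigma> x \<ge> 0" using e0[OF x] by (simp add: zero_le_mult_iff)
    then show ?thesis using neq[OF \<sigma>[of x]] by simp
  qed
  \<comment> \<open>The two flags of one corner carry different labels, so both signs of
    \<open>\<sigma>\<close> occur.\<close>
  obtain x where x: "x \<in> flags G" using cell by (auto simp: cell_decomposition_def)
  then have "flip_edge G x \<in> flags G" "horizontal G (flip_edge G x) = (\<not> horizontal G x)"
    using assms(1) cell by (auto simp: quad_graph_def cell_decomposition_def)
  then have "C - 2 * \<nu> > 0" "C + 2 * \<nu> > 0"
    using pos[OF x] pos[of "flip_edge G x"] by (auto simp: \<sigma>_def split: if_splits)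
  define Rp where "Rp = sqrt (C - 2 * \<nu>)"
  define Rm where "Rm = sqrt (C + 2 * \<nu>)"
  have R: "Rp > 0" "Rm > 0" "Rp\<^sup>2 = C - 2 * \<nu>" "Rm\<^sup>2 = C + 2 * \<nu>"
    using \<open>C - 2 * \<nu> > 0\<close> \<open>C + 2 * \<nu> > 0\<close> by (simp_all add: Rp_def Rm_def)
  \<comment> \<open>This is the scaling for which the product of the two sphere radii
    \<open>\<rho> * Rp\<close> and \<open>\<rho> * Rm\<close> becomes 1.\<close>
  define \<rho> where "\<rho> = 1 / sqrt (Rp * Rm)"
  have \<rho>: "\<rho> > 0" "\<rho>\<^sup>2 * (Rp * Rm) = 1"
    using R by (simp_all add: \<rho>_def power_divide)
  have scaled: "gauss_map (scale_sphere \<rho> \<circ> s) (scale_sphere \<rho> \<circ> sd) = (\<lambda>v. \<rho> *\<^sub>R n v)"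
    by (auto simp: gauss_map_def scale_sphere_def n scaleR_diff_right)
  have par: "\<exists>a. \<rho> *\<^sub>R n (edge_end G x) - \<rho> *\<^sub>R n (vertex_of G x) = a *\<^sub>R e x"
    if x: "x \<in> flags G" for x
    using edge(2)[OF x \<mu>\<nu>] by (metis scaleR_diff_right scaleR_scaleR)
  have "Q_net G (\<lambda>v. \<rho> *\<^sub>R n v)"
    using par unfolding e_def by (intro Q_net_parallel[OF assms(1) iso(1)])
  moreover have "edge_touches_sphere (\<rho> *\<^sub>R n (vertex_of G x)) (\<rho> *\<^sub>R n (edge_end G x))
      (if horizontal G x then \<rho> * Rp else \<rho> * Rm)" if x: "x \<in> flags G" for x
  proof -
    define r where "r = (if horizontal G x then Rp else Rm)"
    have r: "r > 0" "r\<^sup>2 = C - 2 * \<nu> * \<sigma> x" using R by (auto simp: r_def \<sigma>_def)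
    obtain a where a: "\<rho> *\<^sub>R n (edge_end G x) = \<rho> *\<^sub>R n (vertex_of G x) + a *\<^sub>R e x"
      using par[OF x] by (metis diff_eq_eq add.commute)
    have "(\<rho> *\<^sub>R n (vertex_of G x) \<bullet> e x)\<^sup>2 =
        ((norm (\<rho> *\<^sub>R n (vertex_of G x)))\<^sup>2 - (\<rho> * r)\<^sup>2) * (norm (e x))\<^sup>2"
      by (simp only: inner_scaleR_left norm_scaleR power_mult_distrib power2_abs
          sq2[OF x, folded r(2)]) (simp add: algebra_simps)
    then have "edge_touches_sphere (\<rho> *\<^sub>R n (vertex_of G x)) (\<rho> *\<^sub>R n (edge_end G x)) (\<rho> * r)"
      using edge_touches_sphereI[OF e0[OF x] a] \<rho>(1) r(1) by simp
    then show ?thesis by (simp add: r_def if_distrib)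
  qed
  moreover have "\<rho> * Rp > 0" "\<rho> * Rm > 0" "\<rho> * Rp * (\<rho> * Rm) = 1"
    using \<rho> R by (simp_all add: power2_eq_square algebra_simps)
  ultimately have "two_sphere_Koebe_net G (\<lambda>v. \<rho> *\<^sub>R n v)"
    unfolding two_sphere_Koebe_net_def by blast
  then show ?thesis using \<rho>(1) scaled by auto
qed

end
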